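(* For every fixed integer $l_0>0$ there exists a constant $\mathcal{C}=\mathcal{C}(l_0)>0$ such that, as $x\to\infty$, $$\sum_{n\leq x}d(n)d(n+l_0)\geq (1+o(1))\frac{x\log^2 x}{2\,\mathcal{C}(l_0)}.$$
   Context: $d(n)$ is the number of positive divisors of $n$; $\log^2 x=(\log x)^2$. The sum is over positive integers $n$, and $o(1)$ denotes a quantity tending to $0$ as $x\to\infty$. *)

theory Defs
  imports Complex_Main
begin

definition num_divisors :: "nat \<Rightarrow> nat" where
  "num_divisors n = card {k. 0 < k \<and> k dvd n}"

end

theory Submission
  imports Defs "HOL-Number_Theory.Cong" "HOL-Analysis.Harmonic_Numbers"
begin

text \<open>
  Since the constant is at our disposal, it suffices to count only some of the divisors: those
  pairs \<open>a | n\<close>, \<open>b | n + l\<^sub>0\<close> with \<open>a, b \<le> \<surd>x\<close> coprime. By the Chinese remainder theorem each such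
  pair occurs for at least \<open>\<lfloor>x / (a b)\<rfloor> \<ge> x / (2 a b)\<close> values of \<open>n\<close>. Splitting off the gcd shows
  that the sum of \<open>1 / (a b)\<close> over all pairs exceeds that over coprime pairs by at most the
  factor \<open>\<Sum> 1 / g\<^sup>2 \<le> 2\<close>, so the latter is of order \<open>log\<^sup>2 x\<close>.
\<close>

definition coprime_pairs :: "nat \<Rightarrow> (nat \<times> nat) set" where
  "coprime_pairs N = {(a, b). a \<in> {1..N} \<and> b \<in> {1..N} \<and> coprime a b}"

lemma finite_coprime_pairs [simp]: "finite (coprime_pairs N)"
  by (rule finite_subset[of _ "{1..N} \<times> {1..N}"]) (auto simp: coprime_pairs_def)

text \<open>Telescoping: 1/(n+1)^2 is at most 1/n - 1/(n+1). The induction needs the sharper bound 2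
  - 1/N.\<close>

lemma sum_inverse_squares_le_2: "(\<Sum>g = 1..N. 1 / real g ^ 2) \<le> 2"
proof -
  have "(\<Sum>g = 1..N. 1 / real g ^ 2) \<le> 2 - 1 / real N" if "N \<ge> 1"
    using that
  proof (induction N rule: dec_induct)
    case (step n)
    have "1 / real (Suc n) ^ 2 \<le> 1 / (real n * real (Suc n))"
      using step.hyps by (intro divide_left_mono) (auto simp: power2_eq_square)
    also have "\<dots> = 1 / real n - 1 / real (Suc n)"
      using step.hyps by (simp add: field_simps)
    finally show ?case
      using step.IH by simp
  qed simp
  then show ?thesis
    by (cases "N = 0") (auto intro: order_trans)
qed

lemma harm_squared_le_coprime_sum:
  "(harm N)\<^sup>2 \<le> 2 * (\<Sum>(a, b)\<in>coprime_pairs N. 1 / (real a * real b))"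
proof -
  let ?A = "{1..N} \<times> {1..N}"
  let ?f = "\<lambda>(g, a, b). 1 / real g ^ 2 * (1 / (real a * real b))"
  \<comment> \<open>\<open>?h\<close> is injective, since multiplying the cofactors by the gcd
    recovers the pair. It turns the full sum into part of a sum over a product set, which then
    factors.\<close>
  let ?h = "\<lambda>(a, b). (gcd a b, a div gcd a b, b div gcd a b)"
  let ?S = "\<Sum>(a, b)\<in>coprime_pairs N. 1 / (real a * real b)"
  have inj: "inj_on ?h ?A"
  proof (rule inj_onI, clarify)
    fix a b c d :: nat
    assume "gcd a b = gcd c d" "a div gcd a b = c div gcd c d" "b div gcd a b = d div gcd c d"
    then show "a = c \<and> b = d"
      by (metis dvd_mult_div_cancel gcd_dvd1 gcd_dvd2)
  qed
  have sub: "?h ` ?A \<subseteq> {1..N} \<times> coprime_pairs N"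
  proof clarify
    fix a b :: nat
    assume ab: "a \<in> {1..N}" "b \<in> {1..N}"
    then have "gcd a b \<le> a" "gcd a b > 0" "gcd a b \<le> b"
      by (auto intro: dvd_imp_le)
    then have "a div gcd a b > 0" "b div gcd a b > 0" "coprime (a div gcd a b) (b div gcd a b)"
      using ab by (auto simp: div_greater_zero_iff intro: div_gcd_coprime)
    moreover have "a div gcd a b \<le> N" "b div gcd a b \<le> N"
      using ab by (meson atLeastAtMost_iff div_le_dividend le_trans)+
    ultimately show "gcd a b \<in> {1..N} \<and> (a div gcd a b, b div gcd a b) \<in> coprime_pairs N"
      using ab \<open>gcd a b \<le> a\<close> \<open>gcd a b > 0\<close>
      by (simp add: coprime_pairs_def Suc_le_eq del: gcd_pos_nat)
  qed
  have "(harm N)\<^sup>2 = (\<Sum>(a, b)\<in>?A. 1 / (real a * real b))"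
    by (simp add: harm_def power2_eq_square sum_product sum.cartesian_product
        inverse_eq_divide case_prod_unfold)
  also have "\<dots> = (\<Sum>p\<in>?A. ?f (?h p))"
  proof (rule sum.cong, simp, clarify)
    fix a b :: nat
    let ?g = "gcd a b"
    have "real a = real ?g * real (a div ?g)" "real b = real ?g * real (b div ?g)"
      by (simp_all flip: of_nat_mult)
    then have "real a * real b = real ?g ^ 2 * (real (a div ?g) * real (b div ?g))"
      by (simp add: power2_eq_square)
    then show "1 / (real a * real b)
        = 1 / (real ?g)\<^sup>2 * (1 / (real (a div ?g) * real (b div ?g)))"
      by simp
  qed
  also have "\<dots> = sum ?f (?h ` ?A)"
    by (subst sum.reindex[OF inj]) (simp add: comp_def)
  also have "\<dots> \<le> sum ?f ({1..N} \<times> coprime_pairs N)"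
    by (rule sum_mono2[OF _ sub]) auto
  also have "\<dots> = (\<Sum>g = 1..N. 1 / real g ^ 2) * ?S"
    by (simp add: sum_product sum.cartesian_product case_prod_unfold)
  also have "\<dots> \<le> 2 * ?S"
    by (intro mult_right_mono sum_inverse_squares_le_2 sum_nonneg) auto
  finally show ?thesis .
qed

text \<open>The two divisibilities hold on a whole residue class modulo \<open>a * b\<close>, so
  each complete block of \<open>a * b\<close> consecutive integers in \<open>{1..M}\<close>
  contributes a solution.\<close>

lemma card_simultaneous_multiples_ge:
  fixes a b l M :: nat
  assumes "coprime a b" "a > 0" "b > 0"
  shows "M div (a * b) \<le> card {n \<in> {1..M}. a dvd n \<and> b dvd n + l}"
proof -
  \<comment> \<open>Over the naturals, \<open>(b - 1) * l\<close> stands in for -l modulo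
    \<open>b\<close>.\<close>
  obtain z where z: "[z = 0] (mod a)" "[z = (b - 1) * l] (mod b)"
    using binary_chinese_remainder_nat[OF assms(1)] by blast
  have "[z + l = (b - 1) * l + l] (mod b)"
    using z(2) by (rule cong_add) simp
  moreover have "(b - 1) * l + l = b * l"
    using assms by (cases b) auto
  ultimately have zb: "b dvd z + l" and za: "a dvd z"
    using z(1) by (simp_all add: cong_0_iff cong_dvd_iff)
  \<comment> \<open>The representative is taken in 1..ab rather than 0..ab-1: this excludes n = 0
    and keeps \<open>r + k * (a * b)\<close> within \<open>Suc k * (a * b)\<close>.\<close>
  define r where "r = (if z mod (a * b) = 0 then a * b else z mod (a * b))"
  have pos: "a * b > 0" using assms by simp
  have r: "0 < r" "r \<le> a * b"
    using pos by (auto simp: r_def intro: less_imp_le)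
  have "[r = z] (mod a * b)"
    by (auto simp: r_def cong_def)
  then have ra: "a dvd r" and rb: "b dvd r + l"
    using za zb by (metis cong_dvd_iff cong_modulus_mult_nat,
        metis cong_add_rcancel_nat cong_dvd_iff cong_modulus_mult_nat mult.commute)
  let ?h = "\<lambda>k. r + k * (a * b)"
  have "?h ` {..<M div (a * b)} \<subseteq> {n \<in> {1..M}. a dvd n \<and> b dvd n + l}"
  proof clarify
    fix k assume "k < M div (a * b)"
    then have "Suc k * (a * b) \<le> M"
      by (metis Suc_leI div_times_less_eq_dividend le_trans mult_le_mono1)
    then have "?h k \<le> M" using r by simp
    moreover have "b dvd ?h k + l"
    proof -
      have "?h k + l = (r + l) + k * a * b" by (simp add: mult.assoc)
      then show ?thesis using rb by (metis dvd_add dvd_triv_right)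
    qed
    ultimately show "?h k \<in> {1..M} \<and> a dvd ?h k \<and> b dvd ?h k + l"
      using r ra by auto
  qed
  then have "card (?h ` {..<M div (a * b)}) \<le> card {n \<in> {1..M}. a dvd n \<and> b dvd n + l}"
    by (intro card_mono) auto
  moreover have "inj_on ?h {..<M div (a * b)}"
    using pos by (auto simp: inj_on_def)
  ultimately show ?thesis
    by (simp add: card_image)
qed

text \<open>With quotient q \<ge> 1, m < (q + 1) n \<le> 2 q n, so rounding down costs at most a
  factor 2.\<close>

lemma real_half_le_div:
  fixes m n :: nat
  assumes "0 < n" "n \<le> m"
  shows "real m / (2 * real n) \<le> real (m div n)"
proof -
  have "m div n \<ge> 1"
    using assms by (simp add: Suc_leI div_greater_zero_iff)
  then have "n \<le> m div n * n"
    by (metis mult_le_mono1 nat_mult_1)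
  then have "m \<le> 2 * (m div n * n)"
    using mod_less_divisor[OF assms(1), of m] div_mult_mod_eq[of m n] by linarith
  then have "real m \<le> real (2 * (m div n * n))"
    by (simp only: of_nat_le_iff)
  then show ?thesis
    using assms by (simp add: field_simps)
qed

lemma card_coprime_divisor_pairs_le:
  assumes "n > 0"
  shows "card {(a, b) \<in> coprime_pairs N. a dvd n \<and> b dvd n + l}
    \<le> num_divisors n * num_divisors (n + l)"
proof -
  have fin: "finite {k. 0 < k \<and> k dvd m}" if "m > 0" for m :: nat
    using that by simp
  have "card {(a, b) \<in> coprime_pairs N. a dvd n \<and> b dvd n + l}
      \<le> card ({k. 0 < k \<and> k dvd n} \<times> {k. 0 < k \<and> k dvd n + l})"
    using assms fin[of n] fin[of "n + l"]
    by (intro card_mono finite_cartesian_product) (auto simp: coprime_pairs_def)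
  then show ?thesis
    by (simp add: num_divisors_def card_cartesian_product)
qed

text \<open>Double counting of triples (n, a, b). The hypothesis forces \<open>a * b \<le> M\<close>
  for all pairs, as the rounding bound requires. The factor 1/4 combines the 1/2 lost to rounding
  with the 1/2 lost to coprimality.\<close>

lemma sum_num_divisors_product_ge:
  assumes "N * N \<le> M"
  shows "real M / 4 * (harm N)\<^sup>2
    \<le> (\<Sum>n = 1..M. real (num_divisors n) * real (num_divisors (n + l)))"
proof -
  let ?P = "coprime_pairs N"
  have "real M / 4 * (harm N)\<^sup>2
      \<le> real M / 4 * (2 * (\<Sum>(a, b)\<in>?P. 1 / (real a * real b)))"
    by (intro mult_left_mono harm_squared_le_coprime_sum) simp
  also have "\<dots> = (\<Sum>(a, b)\<in>?P. real M / (2 * real (a * b)))"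
    by (simp add: sum_distrib_left case_prod_unfold)
  also have "\<dots> \<le> (\<Sum>(a, b)\<in>?P. real (card {n \<in> {1..M}. a dvd n \<and> b dvd n + l}))"
  proof (rule sum_mono, clarify)
    fix a b assume "(a, b) \<in> ?P"
    then have ab: "coprime a b" "a > 0" "b > 0" "a \<le> N" "b \<le> N"
      by (auto simp: coprime_pairs_def)
    have "a * b \<le> M"
      using mult_le_mono[OF ab(4,5)] assms by linarith
    then have "real M / (2 * real (a * b)) \<le> real (M div (a * b))"
      using ab by (intro real_half_le_div) auto
    also have "\<dots> \<le> real (card {n \<in> {1..M}. a dvd n \<and> b dvd n + l})"
      using card_simultaneous_multiples_ge[OF ab(1-3)] by simp
    finally show "real M / (2 * real (a * b))
      \<le> real (card {n \<in> {1..M}. a dvd n \<and> b dvd n + l})" .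
  qed
  also have "\<dots> = (\<Sum>p\<in>?P. \<Sum>n = 1..M. if fst p dvd n \<and> snd p dvd n + l then 1 else 0)"
    by (simp add: case_prod_unfold sum.If_cases Int_def)
  also have "\<dots> = (\<Sum>n = 1..M. \<Sum>p\<in>?P. if fst p dvd n \<and> snd p dvd n + l then 1 else 0)"
    by (rule sum.swap)
  also have "\<dots> = (\<Sum>n = 1..M. real (card {(a, b) \<in> ?P. a dvd n \<and> b dvd n + l}))"
    by (simp add: case_prod_unfold sum.If_cases Int_def)
  also have "\<dots> \<le> (\<Sum>n = 1..M. real (num_divisors n) * real (num_divisors (n + l)))"
    using card_coprime_divisor_pairs_le
    by (intro sum_mono) (simp flip: of_nat_mult)
  finally show ?thesis .
qed

theorem corollary4p1:
  fixes l\<^sub>0 :: nat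
  assumes "l\<^sub>0 > 0"
  shows "\<exists>C::real. C > 0 \<and>
    (\<exists>e::real \<Rightarrow> real. (e \<longlongrightarrow> 0) at_top \<and>
      (\<forall>\<^sub>F x::real in at_top.
        (\<Sum>n | 0 < n \<and> real n \<le> x. real (num_divisors n) * real (num_divisors (n + l\<^sub>0)))
          \<ge> (1 + e x) * (x * (ln x)\<^sup>2 / (2 * C))))"
\<comment> \<open>With M \<ge> x/2 and \<open>harm N\<close> \<ge> (ln x)/2, the bound M/4 times
  \<open>harm N\<close> squared is at least x (ln x)^2 / 32, hence C = 16. This holds for every x
  \<ge> 1, so the error term can be zero.\<close>
proof (intro exI[of _ 16] exI[of _ "\<lambda>_. 0"] conjI)
  show "\<forall>\<^sub>F x::real in at_top.
      (\<Sum>n | 0 < n \<and> real n \<le> x. real (num_divisors n) * real (num_divisors (n + l\<^sub>0)))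
        \<ge> (1 + 0) * (x * (ln x)\<^sup>2 / (2 * 16))"
    using eventually_ge_at_top[of 1]
  proof eventually_elim
    case (elim x)
    define M where "M = nat \<lfloor>x\<rfloor>"
    define N where "N = nat \<lfloor>sqrt x\<rfloor>"
    have M: "real M \<le> x" "x < real M + 1" "M \<ge> 1"
      using elim unfolding M_def by linarith+
    have "sqrt x \<ge> 1" using elim by simp
    then have N: "real N \<le> sqrt x" "sqrt x < real N + 1" "N \<ge> 1"
      unfolding N_def by linarith+
    have "real (N * N) \<le> sqrt x * sqrt x"
      unfolding of_nat_mult using N elim by (intro mult_mono) auto
    \<comment> \<open>Passing through the strict bound by M + 1 lets integrality give
      \<open>N * N \<le> M\<close>.\<close>
    then have "real (N * N) < real (M + 1)"
      using elim M by simp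
    then have NM: "N * N \<le> M"
      by (simp only: of_nat_less_iff)
    have "ln x / 2 = ln (sqrt x)"
      using elim by (simp add: ln_sqrt)
    also have "\<dots> \<le> ln (real N + 1)"
      using elim N by (subst ln_le_cancel_iff) auto
    also have "\<dots> \<le> harm N"
      by (rule ln_le_harm)
    finally have h: "ln x / 2 \<le> harm N" .
    have "x \<le> 2 * real M"
      using M by linarith
    have "x / 8 * (ln x / 2)\<^sup>2 \<le> real M / 4 * (harm N)\<^sup>2"
      using h \<open>x \<le> 2 * real M\<close> elim by (intro mult_mono power_mono) auto
    also have "\<dots> \<le> (\<Sum>n = 1..M. real (num_divisors n) * real (num_divisors (n + l\<^sub>0)))"
      by (rule sum_num_divisors_product_ge[OF NM])
    also have "{1..M} = {n. 0 < n \<and> real n \<le> x}"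
      using elim unfolding M_def by (auto simp: le_nat_iff le_floor_iff)
    finally show ?case
      by (simp add: power_divide)
  qed
qed simp_all

end
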